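(* Consider the conformable fractional optimal control problem of minimizing $$\mathcal{J}(y,v)=\int_a^b L(x,y(x),v(x))\,d^\alpha_a x\quad\text{subject to}\quad y^{(\alpha)}_a(x)=\varphi(x,y(x),v(x)),$$ with Hamiltonian $H(x,y,v,p)=-L(x,y,v)+p\,\varphi(x,y,v)$. If this problem is invariant, up to the gauge term $\Lambda$, under the transformations $$\overline x=x+\epsilon\,\tau,\quad \overline y=y+\epsilon\,\xi,\quad \overline v=v+\epsilon\,\sigma,\quad \overline p=p+\epsilon\,\pi,$$ where $\tau,\xi,\sigma,\pi$ are functions of $(x,y(x),v(x),p(x))$, and if $(y,v,p)$ is a conformable fractional Pontryagin extremal, then $$\frac{d^\alpha_a}{dx^\alpha_a}(p\,\xi)-\tau\left(\frac{\partial H}{\partial x}+(\alpha-1)\frac{p\,y^{(\alpha)}_a}{x-a}\right)-H\,\frac{\tau^{(\alpha)}_a}{(x-a)^{1-\alpha}}=\frac{d^\alpha_a\Lambda}{dx^\alpha_a}.$$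
   Context: Let $a<b$ be real and $0<\alpha\le1$. The left conformable fractional derivative of order $\alpha$ starting from $a$ of $f:[a,b]\to\mathbb{R}$ is $$f^{(\alpha)}_a(x)=\frac{d^\alpha_a}{dx^\alpha_a}f(x)=\lim_{\epsilon\to0}\frac{f(x+\epsilon(x-a)^{1-\alpha})-f(x)}{\epsilon}$$ (endpoint values being defined as one-sided limits), and $\int_a^b f(x)\,d^\alpha_a x=\int_a^b f(x)(x-a)^{\alpha-1}\,dx$. The functions $L$ and $\varphi$ are at least of class $C^1$ on $[a,b]\times\mathbb{R}^2$; admissible state trajectories $y$ are such that $y^{(\alpha)}_a$ exists, and $p$ is such that $p^{(\alpha)}_a$ exists. $H$ and its partial derivatives are evaluated at $(x,y(x),v(x),p(x))$. A conformable fractional Pontryagin extremal is a triplet $(y,v,p)$ satisfying the fractional Hamiltonian system $$y^{(\alpha)}_a(x)=\frac{\partial H}{\partial p}(x,y,v,p),\qquad p^{(\alpha)}_a(x)=-\frac{\partial H}{\partial y}(x,y,v,p),$$ and the stationary condition $\frac{\partial H}{\partial v}(x,y,v,p)=0$. Here $\epsilon$ is a real parameter with $|\epsilon|\ll1$; $\tau^{(\alpha)}_a$, $\xi^{(\alpha)}_a$ denote the conformable derivatives (assumed to exist) of the functions $x\mapsto\tau(x,y(x),v(x),p(x))$ and $x\mapsto\xi(x,y(x),v(x),p(x))$, and $\frac{d^\alpha_a\Lambda}{dx^\alpha_a}$ that of $x\mapsto\Lambda(x,y(x))$; $\overline x\ge a$. Invariance: the optimal control problem is invariant under the transformations up to the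 gauge term $\Lambda$ if a function $\Lambda=\Lambda(x,y)$ exists such that for any functions $y$, $v$ and $p$, and for any real $x\in[a,b]$, $$\left[-H(\overline x,\overline y,\overline v,\overline p)+\overline p\,\frac{d^\alpha_a\overline y}{d\overline x^\alpha_a}\right]\frac{d^\alpha_a\overline x}{d^\alpha_a x}=-H(x,y,v,p)+p\,y^{(\alpha)}_a+\epsilon\frac{d^\alpha_a\Lambda}{dx^\alpha_a}(x,y)+o(\epsilon)$$ for all $\epsilon$ in some neighborhood of zero, where $$\frac{d^\alpha_a\overline x}{d^\alpha_a x}:=\frac{d^\alpha_a\overline x/dx^\alpha_a}{d^\alpha_a x/dx^\alpha_a}=1+\epsilon\frac{\tau^{(\alpha)}_a}{(x-a)^{1-\alpha}},$$ and $\frac{d^\alpha_a\overline y}{d\overline x^\alpha_a}$ is the conformable derivative of $\overline y$ with respect to $\overline x$, i.e. (by the conformable chain rule) $$\frac{d^\alpha_a\overline y}{d\overline x^\alpha_a}=\frac{y^{(\alpha)}_a+\epsilon\,\xi^{(\alpha)}_a}{(x+\epsilon\tau-a)^{\alpha-1}\left[(x-a)^{1-\alpha}+\epsilon\,\tau^{(\alpha)}_a\right]}.$$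
   Formalization: The identity is proved for a < x ≤ b, since at x = a it divides by x − a; at x = b, p and x ↦ ξ(x,y(x),v(x),p(x)) are also assumed left-continuous, as endpoint derivatives are one-sided limits and the identity can fail if p jumps at b. *)

theory Defs
  imports "HOL-Analysis.Analysis" "HOL-Library.Landau_Symbols"
begin

definition conf_quot :: "real \<Rightarrow> real \<Rightarrow> (real \<Rightarrow> real) \<Rightarrow> real \<Rightarrow> real \<Rightarrow> real" where
  "conf_quot \<alpha> a f x \<epsilon> = (f (x + \<epsilon> * (x - a) powr (1 - \<alpha>)) - f x) / \<epsilon>"

definition conf_deriv_interior :: "real \<Rightarrow> real \<Rightarrow> (real \<Rightarrow> real) \<Rightarrow> real \<Rightarrow> real" where
  "conf_deriv_interior \<alpha> a f x = Lim (at 0) (conf_quot \<alpha> a f x)"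

text \<open>The values at the endpoints are the one-sided limits of the derivative from inside the
  interval. (For \<open>\<alpha> < 1\<close> the difference quotient at \<open>a\<close> itself is identically zero.)\<close>

definition conf_deriv :: "real \<Rightarrow> real \<Rightarrow> real \<Rightarrow> (real \<Rightarrow> real) \<Rightarrow> real \<Rightarrow> real" where
  "conf_deriv \<alpha> a b f x =
     (if x = a then Lim (at_right a) (conf_deriv_interior \<alpha> a f)
      else if x = b then Lim (at_left b) (conf_deriv_interior \<alpha> a f)
      else conf_deriv_interior \<alpha> a f x)"

definition conf_differentiable :: "real \<Rightarrow> real \<Rightarrow> real \<Rightarrow> (real \<Rightarrow> real) \<Rightarrow> bool" where
  "conf_differentiable \<alpha> a b f \<longleftrightarrow>
     (\<forall>x\<in>{a<..<b}. \<exists>d. (conf_quot \<alpha> a f x \<longlongrightarrow> d) (at 0)) \<and>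
     (\<exists>d. (conf_deriv_interior \<alpha> a f \<longlongrightarrow> d) (at_right a)) \<and>
     (\<exists>d. (conf_deriv_interior \<alpha> a f \<longlongrightarrow> d) (at_left b))"

text \<open>The conformable derivative of \<open>Y\<close> with respect to \<open>X\<close>, both given as functions of \<open>x\<close>.
  It is read off from the conformable chain rule
  \<open>Y\<^sup>(\<^sup>\<alpha>\<^sup>) = (dY/dX)\<^sup>(\<^sup>\<alpha>\<^sup>) (X - a)\<^sup>\<alpha>\<^sup>-\<^sup>1 X\<^sup>(\<^sup>\<alpha>\<^sup>)\<close>.\<close>

definition conf_deriv_wrt ::
    "real \<Rightarrow> real \<Rightarrow> real \<Rightarrow> (real \<Rightarrow> real) \<Rightarrow> (real \<Rightarrow> real) \<Rightarrow> real \<Rightarrow> real" where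
  "conf_deriv_wrt \<alpha> a b Y X x =
     conf_deriv \<alpha> a b Y x / ((X x - a) powr (\<alpha> - 1) * conf_deriv \<alpha> a b X x)"

definition C1_on :: "'a::real_normed_vector set \<Rightarrow> ('a \<Rightarrow> 'b::real_normed_vector) \<Rightarrow> bool" where
  "C1_on S f \<longleftrightarrow>
     (\<exists>f'. (\<forall>z\<in>S. (f has_derivative blinfun_apply (f' z)) (at z within S)) \<and> continuous_on S f')"

definition hamiltonian ::
    "(real \<Rightarrow> real \<Rightarrow> real \<Rightarrow> real) \<Rightarrow> (real \<Rightarrow> real \<Rightarrow> real \<Rightarrow> real) \<Rightarrow>
     real \<Rightarrow> real \<Rightarrow> real \<Rightarrow> real \<Rightarrow> real" where
  "hamiltonian L \<phi> x y v p = - L x y v + p * \<phi> x y v"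

definition along ::
    "(real \<Rightarrow> real \<Rightarrow> real \<Rightarrow> real \<Rightarrow> real) \<Rightarrow> (real \<Rightarrow> real) \<Rightarrow> (real \<Rightarrow> real) \<Rightarrow> (real \<Rightarrow> real) \<Rightarrow>
     real \<Rightarrow> real" where
  "along F y v p x = F x (y x) (v x) (p x)"

text \<open>\<open>L\<close> and \<open>\<phi>\<close> only matter for \<open>x\<close> in \<open>[a, b]\<close>, so \<open>\<partial>H/\<partial>x\<close> is one-sided at the endpoints.\<close>

definition dH_dx ::
    "real \<Rightarrow> real \<Rightarrow> (real \<Rightarrow> real \<Rightarrow> real \<Rightarrow> real \<Rightarrow> real) \<Rightarrow> real \<Rightarrow> real \<Rightarrow> real \<Rightarrow> real \<Rightarrow> real" where
  "dH_dx a b H x y v p = vector_derivative (\<lambda>s. H s y v p) (at x within {a..b})"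

definition dH_dy :: "(real \<Rightarrow> real \<Rightarrow> real \<Rightarrow> real \<Rightarrow> real) \<Rightarrow> real \<Rightarrow> real \<Rightarrow> real \<Rightarrow> real \<Rightarrow> real" where
  "dH_dy H x y v p = deriv (\<lambda>s. H x s v p) y"

definition dH_dv :: "(real \<Rightarrow> real \<Rightarrow> real \<Rightarrow> real \<Rightarrow> real) \<Rightarrow> real \<Rightarrow> real \<Rightarrow> real \<Rightarrow> real \<Rightarrow> real" where
  "dH_dv H x y v p = deriv (\<lambda>s. H x y s p) v"

definition dH_dp :: "(real \<Rightarrow> real \<Rightarrow> real \<Rightarrow> real \<Rightarrow> real) \<Rightarrow> real \<Rightarrow> real \<Rightarrow> real \<Rightarrow> real \<Rightarrow> real" where
  "dH_dp H x y v p = deriv (\<lambda>s. H x y v s) p"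

definition conf_pontryagin_extremal ::
    "real \<Rightarrow> real \<Rightarrow> real \<Rightarrow> (real \<Rightarrow> real \<Rightarrow> real \<Rightarrow> real \<Rightarrow> real) \<Rightarrow>
     (real \<Rightarrow> real) \<Rightarrow> (real \<Rightarrow> real) \<Rightarrow> (real \<Rightarrow> real) \<Rightarrow> bool" where
  "conf_pontryagin_extremal \<alpha> a b H y v p \<longleftrightarrow>
     conf_differentiable \<alpha> a b y \<and> conf_differentiable \<alpha> a b p \<and>
     (\<forall>x\<in>{a..b}.
        conf_deriv \<alpha> a b y x = along (dH_dp H) y v p x \<and>
        conf_deriv \<alpha> a b p x = - along (dH_dy H) y v p x \<and>
        along (dH_dv H) y v p x = 0)"

text \<open>The triples for which every conformable derivative occurring in the invariance condition,
  and that of the adjoint variable, exists.\<close>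

definition conf_regular_triple ::
    "real \<Rightarrow> real \<Rightarrow> real \<Rightarrow> (real \<Rightarrow> real \<Rightarrow> real \<Rightarrow> real \<Rightarrow> real) \<Rightarrow>
     (real \<Rightarrow> real \<Rightarrow> real \<Rightarrow> real \<Rightarrow> real) \<Rightarrow> (real \<Rightarrow> real \<Rightarrow> real) \<Rightarrow>
     (real \<Rightarrow> real) \<Rightarrow> (real \<Rightarrow> real) \<Rightarrow> (real \<Rightarrow> real) \<Rightarrow> bool" where
  "conf_regular_triple \<alpha> a b \<tau> \<xi> \<Lambda> y v p \<longleftrightarrow>
     conf_differentiable \<alpha> a b y \<and> conf_differentiable \<alpha> a b p \<and>
     conf_differentiable \<alpha> a b (along \<tau> y v p) \<and>
     conf_differentiable \<alpha> a b (along \<xi> y v p) \<and>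
     conf_differentiable \<alpha> a b (\<lambda>x. \<Lambda> x (y x))"

text \<open>Invariance up to the gauge term \<open>\<Lambda>\<close>. The point \<open>x = a\<close> is left out because \<open>x - a\<close>
  occurs there with nonpositive exponents. The parameter \<open>\<epsilon>\<close> is restricted to values with
  \<open>x + \<epsilon> \<tau> \<in> [a, b]\<close>, where \<open>H\<close> is defined; this is a full neighbourhood of zero for
  \<open>a < x < b\<close>, and contains at least one side of zero for \<open>x = b\<close>.\<close>

definition conf_invariant ::
    "real \<Rightarrow> real \<Rightarrow> real \<Rightarrow> (real \<Rightarrow> real \<Rightarrow> real \<Rightarrow> real \<Rightarrow> real) \<Rightarrow>
     (real \<Rightarrow> real \<Rightarrow> real \<Rightarrow> real \<Rightarrow> real) \<Rightarrow> (real \<Rightarrow> real \<Rightarrow> real \<Rightarrow> real \<Rightarrow> real) \<Rightarrow>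
     (real \<Rightarrow> real \<Rightarrow> real \<Rightarrow> real \<Rightarrow> real) \<Rightarrow> (real \<Rightarrow> real \<Rightarrow> real \<Rightarrow> real \<Rightarrow> real) \<Rightarrow>
     (real \<Rightarrow> real \<Rightarrow> real) \<Rightarrow> bool" where
  "conf_invariant \<alpha> a b H \<tau> \<xi> \<sigma> \<pi> \<Lambda> \<longleftrightarrow>
     (\<forall>y v p. conf_regular_triple \<alpha> a b \<tau> \<xi> \<Lambda> y v p \<longrightarrow>
       (let X = (\<lambda>\<epsilon> x. x + \<epsilon> * along \<tau> y v p x);
            Y = (\<lambda>\<epsilon> x. y x + \<epsilon> * along \<xi> y v p x);
            V = (\<lambda>\<epsilon> x. v x + \<epsilon> * along \<sigma> y v p x);
            P = (\<lambda>\<epsilon> x. p x + \<epsilon> * along \<pi> y v p x)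
        in \<forall>x\<in>{a<..b}.
          (\<lambda>\<epsilon>. (- H (X \<epsilon> x) (Y \<epsilon> x) (V \<epsilon> x) (P \<epsilon> x)
                  + P \<epsilon> x * conf_deriv_wrt \<alpha> a b (Y \<epsilon>) (X \<epsilon>) x)
                * (conf_deriv \<alpha> a b (X \<epsilon>) x / conf_deriv \<alpha> a b (\<lambda>s. s) x)
              - (- along H y v p x + p x * conf_deriv \<alpha> a b y x
                  + \<epsilon> * conf_deriv \<alpha> a b (\<lambda>s. \<Lambda> s (y s)) x))
          \<in> o[at 0 within {\<epsilon>. X \<epsilon> x \<in> {a..b}}](\<lambda>\<epsilon>. \<epsilon>)))"

end

theory Submission
  imports Defs
begin

text \<open>Fix \<open>x\<close>. The invariance condition says that a certain function of \<open>\<epsilon>\<close> is \<open>o(\<epsilon>)\<close>, so its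
  derivative at \<open>\<epsilon> = 0\<close> vanishes. By the chain rule this derivative is
  \<open>- (H\<^sub>x \<tau> + H\<^sub>y \<xi> + H\<^sub>v \<sigma> + H\<^sub>p \<pi>) - H \<tau>' (x-a)\<^sup>\<alpha>\<^sup>-\<^sup>1 + \<pi> y' + p \<xi>' + (1-\<alpha>) p y' \<tau> / (x-a) - \<Lambda>'\<close>
  (primes denote conformable derivatives), and the Hamiltonian system and the stationary condition
  turn it into the claimed identity. Since conformable differentiability at an interior point is
  ordinary differentiability, the calculus rules for \<open>conf_deriv\<close> reduce to the classical
  ones; at \<open>x = b\<close> they are obtained by passing to the limit.\<close>

subsection \<open>Conformable calculus\<close>

text \<open>For \<open>a < x\<close> the factor \<open>c\<close> is nonzero and independent of
  \<open>\<epsilon>\<close>, so the quotient is the classical difference quotient at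
  \<open>0\<close> of \<open>f (x + \<epsilon> * c)\<close> as a function of
  \<open>\<epsilon>\<close>. Composing with an affine map or with its inverse gives the two
  directions.\<close>

lemma conf_quot_tendsto_iff:
  assumes "a < x"
  shows "(conf_quot \<alpha> a f x \<longlongrightarrow> d) (at 0)
    \<longleftrightarrow> (f has_real_derivative d / (x - a) powr (1 - \<alpha>)) (at x)"
proof -
  define c where "c = (x - a) powr (1 - \<alpha>)"
  have c: "c \<noteq> 0" using assms by (simp add: c_def)
  have "(conf_quot \<alpha> a f x \<longlongrightarrow> d) (at 0)
      \<longleftrightarrow> ((\<lambda>\<epsilon>. f (x + \<epsilon> * c)) has_real_derivative d) (at 0)"
    by (simp add: DERIV_def conf_quot_def[abs_def] c_def)
  also have "\<dots> \<longleftrightarrow> (f has_real_derivative d / c) (at x)"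
  proof
    assume *: "((\<lambda>\<epsilon>. f (x + \<epsilon> * c)) has_real_derivative d) (at 0)"
    have "((\<lambda>t. (t - x) / c) has_real_derivative 1 / c) (at x)"
      using c by (auto intro!: derivative_eq_intros)
    moreover have "((\<lambda>\<epsilon>. f (x + \<epsilon> * c)) has_real_derivative d) (at ((x - x) / c))"
      using * by simp
    ultimately have "((\<lambda>t. f (x + (t - x) / c * c)) has_real_derivative d * (1 / c)) (at x)"
      by (rule DERIV_chain2[rotated])
    then show "(f has_real_derivative d / c) (at x)" using c by simp
  next
    assume *: "(f has_real_derivative d / c) (at x)"
    have "((\<lambda>\<epsilon>. x + \<epsilon> * c) has_real_derivative c) (at 0)"
      by (auto intro!: derivative_eq_intros)
    moreover have "(f has_real_derivative d / c) (at (x + 0 * c))" using * by simp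
    ultimately have "((\<lambda>\<epsilon>. f (x + \<epsilon> * c)) has_real_derivative d / c * c) (at 0)"
      by (rule DERIV_chain2[rotated])
    then show "((\<lambda>\<epsilon>. f (x + \<epsilon> * c)) has_real_derivative d) (at 0)" using c by simp
  qed
  finally show ?thesis by (simp add: c_def)
qed

lemma conf_deriv_interior_eqI:
  assumes "a < x" and "(f has_real_derivative d) (at x)"
  shows "conf_deriv_interior \<alpha> a f x = d * (x - a) powr (1 - \<alpha>)"
proof -
  have "(conf_quot \<alpha> a f x \<longlongrightarrow> d * (x - a) powr (1 - \<alpha>)) (at 0)"
    using assms by (simp add: conf_quot_tendsto_iff)
  then show ?thesis unfolding conf_deriv_interior_def by (intro tendsto_Lim) auto
qed

text \<open>Relational form of \<open>conf_deriv\<close> on \<open>{a<..b}\<close>, which lets the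
  calculus rules carry existence and value together. The first conjunct expresses classical
  differentiability on the open interval. At \<open>b\<close> the value is a limit of interior
  derivatives, which does not depend on \<open>f b\<close>.\<close>

definition has_conf_deriv ::
    "real \<Rightarrow> real \<Rightarrow> real \<Rightarrow> (real \<Rightarrow> real) \<Rightarrow> real \<Rightarrow> real \<Rightarrow> bool" where
  "has_conf_deriv \<alpha> a b f d x \<longleftrightarrow>
     (\<forall>s\<in>{a<..<b}. (f has_real_derivative deriv f s) (at s)) \<and>
     (if x = b then ((\<lambda>s. deriv f s * (s - a) powr (1 - \<alpha>)) \<longlongrightarrow> d) (at_left b)
      else d = deriv f x * (x - a) powr (1 - \<alpha>))"

text \<open>\<open>conf_deriv\<close> is built from \<open>Lim\<close>, which is informative only
  when the limit exists; the relation supplies that limit, and uniqueness of limits identifies its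
  value.\<close>

lemma has_conf_deriv_imp_conf_deriv:
  assumes "x \<in> {a<..b}" and f: "has_conf_deriv \<alpha> a b f d x"
  shows "conf_deriv \<alpha> a b f x = d"
proof -
  have int: "conf_deriv_interior \<alpha> a f s = deriv f s * (s - a) powr (1 - \<alpha>)"
    if "s \<in> {a<..<b}" for s
    using that f by (intro conf_deriv_interior_eqI) (auto simp: has_conf_deriv_def)
  show ?thesis
  proof (cases "x = b")
    case True
    have "\<forall>\<^sub>F s in at_left b. s \<in> {a<..<b}"
      using assms True by (intro eventually_at_leftI[of a]) auto
    then have ev: "\<forall>\<^sub>F s in at_left b.
        conf_deriv_interior \<alpha> a f s = deriv f s * (s - a) powr (1 - \<alpha>)"
      by eventually_elim (rule int)
    then have "(conf_deriv_interior \<alpha> a f \<longlongrightarrow> d) (at_left b)"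
      unfolding tendsto_cong[OF ev] using f True by (simp add: has_conf_deriv_def)
    then have "Lim (at_left b) (conf_deriv_interior \<alpha> a f) = d"
      by (intro tendsto_Lim) auto
    then show ?thesis using assms True by (auto simp: conf_deriv_def)
  next
    case False
    then show ?thesis using assms int[of x] by (auto simp: conf_deriv_def has_conf_deriv_def)
  qed
qed

text \<open>At \<open>b\<close> the limit postulated by \<open>conf_differentiable\<close> carries
  over because the interior conformable derivative and its classical expression agree on
  \<open>{a<..<b}\<close>, hence near \<open>b\<close>.\<close>

lemma conf_differentiable_imp_has_conf_deriv:
  assumes x: "x \<in> {a<..b}" and f: "conf_differentiable \<alpha> a b f"
  shows "has_conf_deriv \<alpha> a b f (conf_deriv \<alpha> a b f x) x"
proof -
  have d: "(f has_real_derivative deriv f s) (at s)" if "s \<in> {a<..<b}" for s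
  proof -
    have "\<exists>d. (conf_quot \<alpha> a f s \<longlongrightarrow> d) (at 0)"
      using f that by (simp add: conf_differentiable_def)
    then obtain d where "(conf_quot \<alpha> a f s \<longlongrightarrow> d) (at 0)" by (elim exE)
    then have *: "(f has_real_derivative d / (s - a) powr (1 - \<alpha>)) (at s)"
      using that by (simp add: conf_quot_tendsto_iff)
    show ?thesis using * by (simp only: DERIV_imp_deriv[OF *])
  qed
  have int: "conf_deriv_interior \<alpha> a f s = deriv f s * (s - a) powr (1 - \<alpha>)"
    if "s \<in> {a<..<b}" for s
    using that d by (intro conf_deriv_interior_eqI) auto
  show ?thesis
  proof (cases "x = b")
    case True
    have "\<forall>\<^sub>F s in at_left b. s \<in> {a<..<b}"
      using assms True by (intro eventually_at_leftI[of a]) auto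
    then have ev: "\<forall>\<^sub>F s in at_left b.
        conf_deriv_interior \<alpha> a f s = deriv f s * (s - a) powr (1 - \<alpha>)"
      by eventually_elim (rule int)
    obtain e where "(conf_deriv_interior \<alpha> a f \<longlongrightarrow> e) (at_left b)"
      using f by (auto simp: conf_differentiable_def)
    then have "((\<lambda>s. deriv f s * (s - a) powr (1 - \<alpha>)) \<longlongrightarrow> e) (at_left b)"
      unfolding tendsto_cong[OF ev] .
    with d True have e: "has_conf_deriv \<alpha> a b f e x" unfolding has_conf_deriv_def by auto
    then show ?thesis by (simp only: has_conf_deriv_imp_conf_deriv[OF x e])
  next
    case False
    then have "conf_deriv \<alpha> a b f x = deriv f x * (x - a) powr (1 - \<alpha>)"
      using x int[of x] by (simp add: conf_deriv_def)
    with False d show ?thesis by (simp add: has_conf_deriv_def)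
  qed
qed

text \<open>At \<open>b\<close> the classical product rule is passed to the limit from the left. The
  factors \<open>f s\<close> and \<open>g s\<close> then contribute their left limits, and left
  continuity is what turns these into \<open>f b\<close> and \<open>g b\<close>.\<close>

lemma has_conf_deriv_mult:
  assumes x: "x \<in> {a<..b}"
    and f: "has_conf_deriv \<alpha> a b f d x" and g: "has_conf_deriv \<alpha> a b g e x"
    and cont: "x = b \<Longrightarrow> continuous (at_left b) f \<and> continuous (at_left b) g"
  shows "has_conf_deriv \<alpha> a b (\<lambda>s. f s * g s) (d * g x + f x * e) x"
proof -
  have D: "((\<lambda>s. f s * g s) has_real_derivative deriv f s * g s + f s * deriv g s) (at s)"
    if "s \<in> {a<..<b}" for s
    using DERIV_mult[of f "deriv f s" s UNIV g "deriv g s"] f g that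
    by (simp add: has_conf_deriv_def mult.commute)
  note deq = DERIV_imp_deriv[OF D]
  show ?thesis
  proof (cases "x = b")
    case True
    have "((\<lambda>s. deriv f s * (s - a) powr (1 - \<alpha>) * g s + f s * (deriv g s * (s - a) powr (1 - \<alpha>)))
        \<longlongrightarrow> d * g b + f b * e) (at_left b)"
      using f g True cont by (intro tendsto_intros) (auto simp: has_conf_deriv_def continuous_within)
    moreover have "\<forall>\<^sub>F s in at_left b. s \<in> {a<..<b}"
      using assms True by (intro eventually_at_leftI[of a]) auto
    then have "\<forall>\<^sub>F s in at_left b.
        deriv f s * (s - a) powr (1 - \<alpha>) * g s + f s * (deriv g s * (s - a) powr (1 - \<alpha>))
        = deriv (\<lambda>s. f s * g s) s * (s - a) powr (1 - \<alpha>)"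
      by eventually_elim (simp add: deq algebra_simps)
    ultimately show ?thesis
      using True D deq by (auto simp: has_conf_deriv_def intro: Lim_transform_eventually)
  next
    case False
    then show ?thesis
      using f g D deq x by (auto simp: has_conf_deriv_def algebra_simps)
  qed
qed

text \<open>Only derivatives, and no values of the functions, enter the limit at \<open>b\<close>.
  With \<open>c\<close> as the parameter \<open>\<epsilon>\<close> this differentiates the
  transformed variable and the transformed state.\<close>

lemma has_conf_deriv_add_cmult:
  assumes x: "x \<in> {a<..b}"
    and f: "has_conf_deriv \<alpha> a b f d x" and g: "has_conf_deriv \<alpha> a b g e x"
  shows "has_conf_deriv \<alpha> a b (\<lambda>s. f s + c * g s) (d + c * e) x"
proof -
  have D: "((\<lambda>s. f s + c * g s) has_real_derivative deriv f s + c * deriv g s) (at s)"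
    if "s \<in> {a<..<b}" for s
    using f g that by (intro DERIV_add DERIV_cmult) (auto simp: has_conf_deriv_def)
  note deq = DERIV_imp_deriv[OF D]
  show ?thesis
  proof (cases "x = b")
    case True
    have "((\<lambda>s. deriv f s * (s - a) powr (1 - \<alpha>) + c * (deriv g s * (s - a) powr (1 - \<alpha>)))
        \<longlongrightarrow> d + c * e) (at_left b)"
      using f g True by (intro tendsto_intros) (auto simp: has_conf_deriv_def)
    moreover have "\<forall>\<^sub>F s in at_left b. s \<in> {a<..<b}"
      using assms True by (intro eventually_at_leftI[of a]) auto
    then have "\<forall>\<^sub>F s in at_left b.
        deriv f s * (s - a) powr (1 - \<alpha>) + c * (deriv g s * (s - a) powr (1 - \<alpha>))
        = deriv (\<lambda>s. f s + c * g s) s * (s - a) powr (1 - \<alpha>)"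
      by eventually_elim (simp add: deq algebra_simps)
    ultimately show ?thesis
      using True D deq by (auto simp: has_conf_deriv_def intro: Lim_transform_eventually)
  next
    case False
    then show ?thesis
      using f g D deq x by (auto simp: has_conf_deriv_def algebra_simps)
  qed
qed

text \<open>Supplies the denominator in the invariance condition; at \<open>b\<close> the limit is
  continuity of the power at \<open>b - a > 0\<close>.\<close>

lemma has_conf_deriv_ident:
  assumes x: "x \<in> {a<..b}"
  shows "has_conf_deriv \<alpha> a b (\<lambda>s. s) ((x - a) powr (1 - \<alpha>)) x"
proof -
  have "((\<lambda>s. 1 * (s - a) powr (1 - \<alpha>)) \<longlongrightarrow> (b - a) powr (1 - \<alpha>)) (at_left b)"
    using x by (auto intro!: tendsto_eq_intros)
  then show ?thesis by (auto simp: has_conf_deriv_def)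
qed

subsection \<open>The chain rule for the Hamiltonian\<close>

text \<open>The numbers \<open>Fx\<close>, \<open>Fy\<close>, \<open>Fv\<close> are the coordinates
  of a total derivative, which is more than the existence of partial derivatives. At
  \<open>x = a\<close> and \<open>x = b\<close> it is one-sided in the first variable.\<close>

definition has_partials ::
    "real \<Rightarrow> real \<Rightarrow> (real \<Rightarrow> real \<Rightarrow> real \<Rightarrow> real) \<Rightarrow> real \<Rightarrow> real \<Rightarrow> real \<Rightarrow>
     real \<Rightarrow> real \<Rightarrow> real \<Rightarrow> bool" where
  "has_partials a b F x y v Fx Fy Fv \<longleftrightarrow>
     ((\<lambda>(x, y, v). F x y v) has_derivative (\<lambda>(h, k, l). Fx * h + Fy * k + Fv * l))
       (at (x, y, v) within {a..b} \<times> UNIV \<times> UNIV)"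

text \<open>A linear map on triples is determined by its values at the three basis vectors, and
  these values are the coefficients.\<close>

lemma C1_on_imp_has_partials:
  assumes "C1_on ({a..b} \<times> UNIV \<times> UNIV) (\<lambda>(x, y, v). F x y v)" and "x \<in> {a..b}"
  obtains Fx Fy Fv where "has_partials a b F x y v Fx Fy Fv"
proof -
  obtain F' where "\<forall>z\<in>{a..b} \<times> UNIV \<times> UNIV. ((\<lambda>(x, y, v). F x y v) has_derivative
      blinfun_apply (F' z)) (at z within {a..b} \<times> UNIV \<times> UNIV)"
    using assms(1) unfolding C1_on_def by (elim exE conjE)
  from bspec[OF this, of "(x, y, v)"] assms(2)
  obtain D :: "(real \<times> real \<times> real) \<Rightarrow>\<^sub>L real" where
    D: "((\<lambda>(x, y, v). F x y v) has_derivative blinfun_apply D)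
      (at (x, y, v) within {a..b} \<times> UNIV \<times> UNIV)"
    by simp
  have lin: "blinfun_apply D (h, k, l) = D (1, 0, 0) * h + D (0, 1, 0) * k + D (0, 0, 1) * l" for h k l
  proof -
    have "D (h, k, l) = D (h *\<^sub>R (1, 0, 0) + k *\<^sub>R (0, 1, 0) + l *\<^sub>R (0, 0, 1))" by simp
    also have "\<dots> = D (1, 0, 0) * h + D (0, 1, 0) * k + D (0, 0, 1) * l"
      by (simp only: blinfun.add_right blinfun.scaleR_right real_scaleR_def mult.commute)
    finally show ?thesis .
  qed
  have eq: "blinfun_apply D
      = (\<lambda>(h, k, l). D (1, 0, 0) * h + D (0, 1, 0) * k + D (0, 0, 1) * l)"
  proof
    fix z :: "real \<times> real \<times> real"
    obtain h k l where z: "z = (h, k, l)" by (cases z)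
    show "blinfun_apply D z
        = (case z of (h, k, l) \<Rightarrow> D (1, 0, 0) * h + D (0, 1, 0) * k + D (0, 0, 1) * l)"
      unfolding z prod.case by (rule lin)
  qed
  have "has_partials a b F x y v (D (1, 0, 0)) (D (0, 1, 0)) (D (0, 0, 1))"
    unfolding has_partials_def eq[symmetric] by (rule D)
  then show ?thesis by (rule that)
qed

text \<open>The inclusion for \<open>X\<close> keeps the curve in the slab where \<open>F\<close> is
  differentiable, so the total derivative restricts to the image of \<open>S\<close>.\<close>

lemma has_partials_chain:
  assumes "has_partials a b F (X t) (Y t) (V t) Fx Fy Fv"
    and "X ` S \<subseteq> {a..b}"
    and "(X has_real_derivative X') (at t within S)"
    and "(Y has_real_derivative Y') (at t within S)"
    and "(V has_real_derivative V') (at t within S)"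
  shows "((\<lambda>s. F (X s) (Y s) (V s)) has_real_derivative Fx * X' + Fy * Y' + Fv * V')
    (at t within S)"
proof -
  have "((\<lambda>s. (X s, Y s, V s)) has_derivative (\<lambda>h. (X' * h, Y' * h, V' * h))) (at t within S)"
    using assms(3-5) unfolding has_field_derivative_def by (intro has_derivative_Pair)
  moreover have "((\<lambda>(x, y, v). F x y v) has_derivative (\<lambda>(h, k, l). Fx * h + Fy * k + Fv * l))
      (at (X t, Y t, V t) within (\<lambda>s. (X s, Y s, V s)) ` S)"
    using assms(1) unfolding has_partials_def by (rule has_derivative_subset) (use assms(2) in auto)
  ultimately have "((\<lambda>(x, y, v). F x y v) \<circ> (\<lambda>s. (X s, Y s, V s)) has_derivative
      (\<lambda>(h, k, l). Fx * h + Fy * k + Fv * l) \<circ> (\<lambda>h. (X' * h, Y' * h, V' * h))) (at t within S)"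
    by (rule diff_chain_within)
  moreover have "(\<lambda>(h, k, l). Fx * h + Fy * k + Fv * l) \<circ> (\<lambda>h. (X' * h, Y' * h, V' * h))
      = (*) (Fx * X' + Fy * Y' + Fv * V')"
    by (auto simp: algebra_simps)
  ultimately show ?thesis
    by (simp add: has_field_derivative_def o_def)
qed

lemma hamiltonian_chain:
  assumes ab: "a < b" and x: "x \<in> {a..b}"
    and L: "C1_on ({a..b} \<times> UNIV \<times> UNIV) (\<lambda>(x, y, v). L x y v)"
    and \<phi>: "C1_on ({a..b} \<times> UNIV \<times> UNIV) (\<lambda>(x, y, v). \<phi> x y v)"
    and H: "H = hamiltonian L \<phi>"
    and S: "X ` S \<subseteq> {a..b}"
    and t: "X t = x" "Y t = y" "V t = v" "P t = p"
    and d: "(X has_real_derivative X') (at t within S)"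
      "(Y has_real_derivative Y') (at t within S)"
      "(V has_real_derivative V') (at t within S)"
      "(P has_real_derivative P') (at t within S)"
  shows "((\<lambda>s. H (X s) (Y s) (V s) (P s)) has_real_derivative
     dH_dx a b H x y v p * X' + dH_dy H x y v p * Y' + dH_dv H x y v p * V' + dH_dp H x y v p * P')
    (at t within S)"
proof -
  obtain Lx Ly Lv where PL: "has_partials a b L x y v Lx Ly Lv"
    using C1_on_imp_has_partials[OF L x] .
  obtain \<phi>x \<phi>y \<phi>v where P\<phi>: "has_partials a b \<phi> x y v \<phi>x \<phi>y \<phi>v"
    using C1_on_imp_has_partials[OF \<phi> x] .
  \<comment> \<open>Proved for arbitrary curves: those moving one coordinate only will identify the
    coefficients as the partial derivatives of \<open>H\<close>.\<close>
  have chain: "((\<lambda>s. H (X s) (Y s) (V s) (P s)) has_real_derivative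
      (p * \<phi>x - Lx) * X' + (p * \<phi>y - Ly) * Y' + (p * \<phi>v - Lv) * V' + \<phi> x y v * P')
      (at t within S)"
    if S: "X ` S \<subseteq> {a..b}" and t: "X t = x" "Y t = y" "V t = v" "P t = p"
      and d: "(X has_real_derivative X') (at t within S)"
        "(Y has_real_derivative Y') (at t within S)"
        "(V has_real_derivative V') (at t within S)"
        "(P has_real_derivative P') (at t within S)"
    for X Y V P :: "real \<Rightarrow> real" and S t X' Y' V' P'
  proof -
    have "((\<lambda>s. L (X s) (Y s) (V s)) has_real_derivative Lx * X' + Ly * Y' + Lv * V')
        (at t within S)"
      using PL S d by (intro has_partials_chain) (simp_all add: t)
    moreover have "((\<lambda>s. \<phi> (X s) (Y s) (V s)) has_real_derivative \<phi>x * X' + \<phi>y * Y' + \<phi>v * V')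
        (at t within S)"
      using P\<phi> S d by (intro has_partials_chain) (simp_all add: t)
    ultimately show ?thesis
      unfolding H hamiltonian_def using d(4)
      by (auto intro!: derivative_eq_intros simp: t algebra_simps)
  qed
  \<comment> \<open>The first coordinate may move only inside \<open>{a..b}\<close>; uniqueness of
    the derivative within this interval rests on \<open>a < b\<close>.\<close>
  have "((\<lambda>s. H s y v p) has_real_derivative p * \<phi>x - Lx) (at x within {a..b})"
    using chain[of "\<lambda>s. s" "{a..b}" x "\<lambda>_. y" "\<lambda>_. v" "\<lambda>_. p" 1 0 0 0] by simp
  then have Hx: "dH_dx a b H x y v p = p * \<phi>x - Lx"
    unfolding dH_dx_def using ab x
    by (intro vector_derivative_within_closed_interval)
      (auto simp: has_real_derivative_iff_has_vector_derivative)
  have "((\<lambda>s. H x s v p) has_real_derivative p * \<phi>y - Ly) (at y)"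
    using chain[of "\<lambda>_. x" UNIV y "\<lambda>s. s" "\<lambda>_. v" "\<lambda>_. p" 0 1 0 0] x by simp
  then have Hy: "dH_dy H x y v p = p * \<phi>y - Ly"
    unfolding dH_dy_def by (rule DERIV_imp_deriv)
  have "((\<lambda>s. H x y s p) has_real_derivative p * \<phi>v - Lv) (at v)"
    using chain[of "\<lambda>_. x" UNIV v "\<lambda>_. y" "\<lambda>s. s" "\<lambda>_. p" 0 0 1 0] x by simp
  then have Hv: "dH_dv H x y v p = p * \<phi>v - Lv"
    unfolding dH_dv_def by (rule DERIV_imp_deriv)
  have "((\<lambda>s. H x y v s) has_real_derivative \<phi> x y v) (at p)"
    using chain[of "\<lambda>_. x" UNIV p "\<lambda>_. y" "\<lambda>_. v" "\<lambda>s. s" 0 0 0 1] x by simp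
  then have Hp: "dH_dp H x y v p = \<phi> x y v"
    unfolding dH_dp_def by (rule DERIV_imp_deriv)
  show ?thesis
    unfolding Hx Hy Hv Hp by (rule chain) fact+
qed

subsection \<open>Differentiation with respect to the parameter\<close>

text \<open>Needed for uniqueness of derivatives in the parameter. Since \<open>a < x\<close>, there
  is room to the left of \<open>x\<close> even when \<open>x = b\<close>, so small
  \<open>\<epsilon>\<close> with \<open>\<epsilon> * \<tau> \<le> 0\<close> are admissible; the sign
  of \<open>\<tau>\<close> decides on which side of \<open>0\<close> they lie.\<close>

lemma at_0_within_segment_neq_bot:
  fixes a b x \<tau> :: real
  assumes "a < x" "x \<le> b"
  shows "at 0 within {\<epsilon>. x + \<epsilon> * \<tau> \<in> {a..b}} \<noteq> bot"
proof -
  \<comment> \<open>The summand \<open>1\<close> keeps the denominator positive when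
    \<open>\<tau> = 0\<close>.\<close>
  define r where "r = (x - a) / (1 + \<bar>\<tau>\<bar>)"
  have r: "0 < r" using assms by (simp add: r_def)
  have small: "\<bar>\<epsilon> * \<tau>\<bar> \<le> x - a" if "\<bar>\<epsilon>\<bar> \<le> r" for \<epsilon>
  proof -
    have "\<bar>\<epsilon> * \<tau>\<bar> \<le> \<bar>\<epsilon>\<bar> * (1 + \<bar>\<tau>\<bar>)" by (simp add: abs_mult algebra_simps)
    also have "\<dots> \<le> r * (1 + \<bar>\<tau>\<bar>)" using that by (intro mult_right_mono) auto
    also have "\<dots> = x - a" by (simp add: r_def)
    finally show ?thesis .
  qed
  show ?thesis
  proof (cases "\<tau> \<ge> 0")
    case True
    have "{-r..0} \<subseteq> {\<epsilon>. x + \<epsilon> * \<tau> \<in> {a..b}}"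
      proof
      fix \<epsilon> assume "\<epsilon> \<in> {-r..0}"
      then have "\<bar>\<epsilon> * \<tau>\<bar> \<le> x - a" "\<epsilon> * \<tau> \<le> 0"
        using True by (auto intro!: small mult_nonpos_nonneg)
      then show "\<epsilon> \<in> {\<epsilon>. x + \<epsilon> * \<tau> \<in> {a..b}}" using assms by (simp add: abs_le_iff)
    qed
    moreover have "at 0 within {-r..0} \<noteq> bot"
      using r by (simp add: at_within_Icc_at_left)
    ultimately show ?thesis using at_le[of "{-r..0}" "{\<epsilon>. x + \<epsilon> * \<tau> \<in> {a..b}}" 0] by (auto simp: bot_unique)
  next
    case False
    have "{0..r} \<subseteq> {\<epsilon>. x + \<epsilon> * \<tau> \<in> {a..b}}"
      proof
      fix \<epsilon> assume "\<epsilon> \<in> {0..r}"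
      then have "\<bar>\<epsilon> * \<tau>\<bar> \<le> x - a" "\<epsilon> * \<tau> \<le> 0"
        using False by (auto intro!: small mult_nonneg_nonpos)
      then show "\<epsilon> \<in> {\<epsilon>. x + \<epsilon> * \<tau> \<in> {a..b}}" using assms by (simp add: abs_le_iff)
    qed
    moreover have "at 0 within {0..r} \<noteq> bot"
      using r by (simp add: at_within_Icc_at_right)
    ultimately show ?thesis using at_le[of "{0..r}" "{\<epsilon>. x + \<epsilon> * \<tau> \<in> {a..b}}" 0] by (auto simp: bot_unique)
  qed
qed

text \<open>As \<open>g 0 = 0\<close>, the ratio \<open>g \<epsilon> / \<epsilon>\<close> is the
  difference quotient of \<open>g\<close> at \<open>0\<close>.\<close>

lemma smallo_ident_imp_derivative_0:
  fixes g :: "real \<Rightarrow> real"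
  assumes "g \<in> o[at 0 within S](\<lambda>\<epsilon>. \<epsilon>)" and "g 0 = 0"
  shows "(g has_real_derivative 0) (at 0 within S)"
  using smalloD_tendsto[OF assms(1)] assms(2) by (simp add: has_field_derivative_iff)

section \<open>The invariance condition differentiated along an extremal\<close>

theorem theorem34:
  fixes a b \<alpha> :: real
    and L \<phi> :: "real \<Rightarrow> real \<Rightarrow> real \<Rightarrow> real"
    and H \<tau> \<xi> \<sigma> \<pi> :: "real \<Rightarrow> real \<Rightarrow> real \<Rightarrow> real \<Rightarrow> real"
    and \<Lambda> :: "real \<Rightarrow> real \<Rightarrow> real"
    and y v p :: "real \<Rightarrow> real"
    and x :: real
  assumes "a < b" and "0 < \<alpha>" and "\<alpha> \<le> 1"
    and "C1_on ({a..b} \<times> UNIV \<times> UNIV) (\<lambda>(x, y, v). L x y v)"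
    and "C1_on ({a..b} \<times> UNIV \<times> UNIV) (\<lambda>(x, y, v). \<phi> x y v)"
    and "H = hamiltonian L \<phi>"
    and "conf_invariant \<alpha> a b H \<tau> \<xi> \<sigma> \<pi> \<Lambda>"
    and "conf_pontryagin_extremal \<alpha> a b H y v p"
    and "conf_regular_triple \<alpha> a b \<tau> \<xi> \<Lambda> y v p"
    and "x \<in> {a<..b}"
    and "x = b \<Longrightarrow> continuous (at_left b) p \<and> continuous (at_left b) (along \<xi> y v p)"
  shows "conf_deriv \<alpha> a b (\<lambda>s. p s * along \<xi> y v p s) x
       - along \<tau> y v p x * (along (dH_dx a b H) y v p x
                             + (\<alpha> - 1) * (p x * conf_deriv \<alpha> a b y x / (x - a)))
       - along H y v p x * (conf_deriv \<alpha> a b (along \<tau> y v p) x / (x - a) powr (1 - \<alpha>))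
     = conf_deriv \<alpha> a b (\<lambda>s. \<Lambda> s (y s)) x"
proof -
  note ab = assms(1) and inv = assms(7) and ext = assms(8) and reg = assms(9) and x = assms(10)
  define S where "S = {\<epsilon>. x + \<epsilon> * along \<tau> y v p x \<in> {a..b}}"
  define w where "w = x - a"
  define A where "A = w powr (1 - \<alpha>)"
  define T \<Xi> U W where vars: "T = along \<tau> y v p x" "\<Xi> = along \<xi> y v p x"
    "U = along \<sigma> y v p x" "W = along \<pi> y v p x"
  define y' p' T' \<Xi>' \<Lambda>' where derivs: "y' = conf_deriv \<alpha> a b y x" "p' = conf_deriv \<alpha> a b p x"
    "T' = conf_deriv \<alpha> a b (along \<tau> y v p) x" "\<Xi>' = conf_deriv \<alpha> a b (along \<xi> y v p) x"
    "\<Lambda>' = conf_deriv \<alpha> a b (\<lambda>s. \<Lambda> s (y s)) x"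
  define h where "h = (\<lambda>\<epsilon>. H (x + \<epsilon> * T) (y x + \<epsilon> * \<Xi>) (v x + \<epsilon> * U) (p x + \<epsilon> * W))"
  have w: "0 < w" using x by (simp add: w_def)
  have A: "0 < A" using w by (simp add: A_def)
  then have "A \<noteq> 0" by simp
  have xab: "x \<in> {a..b}" using x by auto

  have cd: "has_conf_deriv \<alpha> a b y y' x" "has_conf_deriv \<alpha> a b p p' x"
    "has_conf_deriv \<alpha> a b (along \<tau> y v p) T' x" "has_conf_deriv \<alpha> a b (along \<xi> y v p) \<Xi>' x"
    using reg x by (auto simp: conf_regular_triple_def derivs
        intro!: conf_differentiable_imp_has_conf_deriv)
  note cdI = has_conf_deriv_imp_conf_deriv[OF x]
  have ident: "conf_deriv \<alpha> a b (\<lambda>s. s) x = A"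
    using cdI[OF has_conf_deriv_ident[OF x]] by (simp add: A_def w_def)
  have DX: "conf_deriv \<alpha> a b (\<lambda>s. s + \<epsilon> * along \<tau> y v p s) x = A + \<epsilon> * T'" for \<epsilon>
    using cdI[OF has_conf_deriv_add_cmult[OF x has_conf_deriv_ident[OF x] cd(3)]]
    by (simp add: A_def w_def)
  have DY: "conf_deriv \<alpha> a b (\<lambda>s. y s + \<epsilon> * along \<xi> y v p s) x = y' + \<epsilon> * \<Xi>'" for \<epsilon>
    using cdI[OF has_conf_deriv_add_cmult[OF x cd(1) cd(4)]] .
  \<comment> \<open>Left continuity at \<open>b\<close> of \<open>p\<close> and of
    \<open>\<xi>\<close> along the triple enters here, through the product rule.\<close>
  have Dp\<xi>: "conf_deriv \<alpha> a b (\<lambda>s. p s * along \<xi> y v p s) x = p' * \<Xi> + p x * \<Xi>'"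
    using cdI[OF has_conf_deriv_mult[OF x cd(2) cd(4) assms(11)]] by (simp add: vars)

  \<comment> \<open>The left side of the invariance condition minus the right side. The conformable
    derivatives of the transformed functions are exactly affine in \<open>\<epsilon>\<close>, so no
    remainder is dropped.\<close>
  define g where "g = (\<lambda>\<epsilon>. (- h \<epsilon> + (p x + \<epsilon> * W)
        * ((y' + \<epsilon> * \<Xi>') / ((w + \<epsilon> * T) powr (\<alpha> - 1) * (A + \<epsilon> * T')))) * ((A + \<epsilon> * T') / A)
      - (- along H y v p x + p x * y' + \<epsilon> * \<Lambda>'))"
  have wpow: "w powr (\<alpha> - 1) = 1 / A"
    using w by (simp add: A_def powr_minus_divide[symmetric])
  have h0: "h 0 = along H y v p x" by (simp add: h_def along_def)
  note inv' = inv[unfolded conf_invariant_def Let_def, rule_format, OF reg x,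
      unfolded conf_deriv_wrt_def DX DY ident]
  have shift: "x + \<epsilon> * T - a = w + \<epsilon> * T" for \<epsilon> by (simp add: w_def)
  have "g \<in> o[at 0 within S](\<lambda>\<epsilon>. \<epsilon>)"
    using inv'[folded vars derivs, unfolded shift] by (simp only: g_def h_def S_def vars)
  moreover have "g 0 = 0" using A by (simp add: g_def wpow h0)
  ultimately have g0: "(g has_real_derivative 0) (at 0 within S)"
    by (rule smallo_ident_imp_derivative_0)

  have h': "(h has_real_derivative along (dH_dx a b H) y v p x * T + along (dH_dy H) y v p x * \<Xi>
      + along (dH_dv H) y v p x * U + along (dH_dp H) y v p x * W) (at 0 within S)"
    unfolding along_def h_def
    by (rule hamiltonian_chain[OF ab xab assms(4-6)])
      (auto simp: S_def vars intro!: derivative_eq_intros)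
  \<comment> \<open>Differentiating the weight of the moved point is the source of the term with
    \<open>(\<alpha> - 1) / (x - a)\<close> in the conclusion.\<close>
  have powr': "((\<lambda>\<epsilon>. (w + \<epsilon> * T) powr (1 - \<alpha>)) has_real_derivative (1 - \<alpha>) * A * T / w)
      (at 0 within S)"
  proof -
    have "((\<lambda>z. z powr (1 - \<alpha>)) has_real_derivative (1 - \<alpha>) * w powr (1 - \<alpha> - 1))
        (at (w + 0 * T))"
      using has_real_derivative_powr[OF w, of "1 - \<alpha>"] by simp
    moreover have "((\<lambda>\<epsilon>. w + \<epsilon> * T) has_real_derivative T) (at 0 within S)"
      by (auto intro!: derivative_eq_intros)
    ultimately have "((\<lambda>\<epsilon>. (w + \<epsilon> * T) powr (1 - \<alpha>)) has_real_derivative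
        (1 - \<alpha>) * w powr (1 - \<alpha> - 1) * T) (at 0 within S)"
      by (rule DERIV_chain2)
    moreover have "w powr (1 - \<alpha> - 1) = A / w"
      using w unfolding A_def by (subst powr_diff) simp
    ultimately show ?thesis by simp
  qed
  \<comment> \<open>\<open>G\<close> is \<open>g\<close> with the factor
    \<open>A + \<epsilon> * T'\<close> cancelled in the momentum term, where it occurs in numerator
    and denominator; products and one power remain.\<close>
  define G where "G = (\<lambda>\<epsilon>. - h \<epsilon> * ((A + \<epsilon> * T') / A)
      + (p x + \<epsilon> * W) * (y' + \<epsilon> * \<Xi>') * (w + \<epsilon> * T) powr (1 - \<alpha>) / A
      - (- along H y v p x + p x * y' + \<epsilon> * \<Lambda>'))"
  have "(G has_real_derivative
      - (along (dH_dx a b H) y v p x * T + along (dH_dy H) y v p x * \<Xi>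
          + along (dH_dv H) y v p x * U + along (dH_dp H) y v p x * W)
      - along H y v p x * (T' / A) + W * y' + p x * \<Xi>' + (1 - \<alpha>) * p x * y' * T / w - \<Lambda>')
      (at 0 within S)"
  proof -
    have "((\<lambda>\<epsilon>. (A + \<epsilon> * T') / A) has_real_derivative T' / A) (at 0 within S)"
      using \<open>A \<noteq> 0\<close> by (auto intro!: derivative_eq_intros)
    from DERIV_mult[OF DERIV_minus[OF h'] this]
    have 1: "((\<lambda>\<epsilon>. - h \<epsilon> * ((A + \<epsilon> * T') / A)) has_real_derivative
        - (along (dH_dx a b H) y v p x * T + along (dH_dy H) y v p x * \<Xi>
          + along (dH_dv H) y v p x * U + along (dH_dp H) y v p x * W)
        - along H y v p x * (T' / A)) (at 0 within S)"
      using \<open>A \<noteq> 0\<close> by (simp add: h0 mult.commute)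
    have 2: "((\<lambda>\<epsilon>. (p x + \<epsilon> * W) * (y' + \<epsilon> * \<Xi>')) has_real_derivative W * y' + p x * \<Xi>')
        (at 0 within S)"
      by (auto intro!: derivative_eq_intros)
    have 3: "((\<lambda>\<epsilon>. (w + \<epsilon> * T) powr (1 - \<alpha>) / A) has_real_derivative (1 - \<alpha>) * T / w)
        (at 0 within S)"
      using DERIV_cdivide[OF powr', of A] \<open>A \<noteq> 0\<close> by simp
    from DERIV_mult[OF 2 3]
    have 4: "((\<lambda>\<epsilon>. (p x + \<epsilon> * W) * (y' + \<epsilon> * \<Xi>') * ((w + \<epsilon> * T) powr (1 - \<alpha>) / A))
        has_real_derivative W * y' + p x * \<Xi>' + (1 - \<alpha>) * p x * y' * T / w) (at 0 within S)"
      using \<open>A \<noteq> 0\<close> by (simp add: A_def[symmetric] mult_ac)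
    have 5: "((\<lambda>\<epsilon>. - along H y v p x + p x * y' + \<epsilon> * \<Lambda>') has_real_derivative \<Lambda>') (at 0 within S)"
      by (auto intro!: derivative_eq_intros)
    from DERIV_diff[OF DERIV_add[OF 1 4] 5] show ?thesis
      by (simp add: G_def add.assoc)
  qed
  moreover have "(G has_real_derivative 0) (at 0 within S)"
  proof (rule has_field_derivative_transform_within)
    \<comment> \<open>Within this radius both \<open>w + \<epsilon> * T\<close> and
      \<open>A + \<epsilon> * T'\<close> stay positive, and the latter can be cancelled.\<close>
    let ?r = "min (w / (1 + \<bar>T\<bar>)) (A / (1 + \<bar>T'\<bar>))"
    show "0 < ?r" using w A by (simp add: add_pos_nonneg)
    show "0 \<in> S" using xab by (simp add: S_def)
    have pos: "0 < u + \<epsilon> * z" if "0 < u" "\<bar>\<epsilon>\<bar> < u / (1 + \<bar>z\<bar>)" for u z \<epsilon> :: real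
    proof -
      have "\<bar>\<epsilon> * z\<bar> \<le> \<bar>\<epsilon>\<bar> * (1 + \<bar>z\<bar>)" by (simp add: abs_mult algebra_simps)
      also have "\<dots> < u" using that by (simp add: pos_less_divide_eq add_pos_nonneg)
      finally show ?thesis by linarith
    qed
    show "g \<epsilon> = G \<epsilon>" if "\<epsilon> \<in> S" "dist \<epsilon> 0 < ?r" for \<epsilon>
    proof -
      have B: "0 < w + \<epsilon> * T" "0 < A + \<epsilon> * T'"
        using that w A by (intro pos; simp)+
      have q: "(w + \<epsilon> * T) powr (\<alpha> - 1) = 1 / (w + \<epsilon> * T) powr (1 - \<alpha>)"
        by (simp add: powr_minus_divide[symmetric])
      have cancel: "(- k + u * (q / (1 / e * c))) * (c / A) = - k * (c / A) + u * q * (e / A)"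
        if "0 < c" for k u q e c :: real
        using that A by (simp add: divide_simps)
      show ?thesis
        unfolding g_def G_def q cancel[OF B(2)] by (simp only: times_divide_eq_right)
    qed
  qed (rule g0)
  \<comment> \<open>Non-triviality of the filter makes the two derivatives found for
    \<open>G\<close> equal.\<close>
  moreover have "at 0 within S \<noteq> bot"
    unfolding S_def using x by (intro at_0_within_segment_neq_bot) auto
  ultimately have "- (along (dH_dx a b H) y v p x * T + along (dH_dy H) y v p x * \<Xi>
          + along (dH_dv H) y v p x * U + along (dH_dp H) y v p x * W)
      - along H y v p x * (T' / A) + W * y' + p x * \<Xi>' + (1 - \<alpha>) * p x * y' * T / w - \<Lambda>' = 0"
    by (rule has_field_derivative_unique)
  \<comment> \<open>These remove the terms with \<open>W\<close> and \<open>U\<close> and leave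
    \<open>p' * \<Xi> + p x * \<Xi>'\<close>, the conformable derivative of the product.\<close>
  moreover have "along (dH_dp H) y v p x = y'" "along (dH_dy H) y v p x = - p'"
    "along (dH_dv H) y v p x = 0"
    using ext xab by (auto simp: conf_pontryagin_extremal_def derivs)
  ultimately show ?thesis
    unfolding Dp\<xi> unfolding vars[symmetric] derivs[symmetric] w_def[symmetric] A_def[symmetric]
    by (simp add: algebra_simps diff_divide_distrib)
qed

end
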